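(* Let $X\in G$ satisfy $X\in USS(X)$ and let $s$ be a minimal simple element for $X$ (with respect to $USS(X)$). Then exactly one of the following holds: (1) $\varphi(X)s$ is a simple element; (2) the pair $\varphi(X), s$ is left weighted, i.e. $\varphi(X)s$ is in left normal form as written.
   Context: $G$ is a Garside group: it has a lattice order $\preccurlyeq$ invariant under left multiplication ($a\preccurlyeq b$ iff $a^{-1}b\in P$, where $P=\{p\in G:1\preccurlyeq p\}$ is the monoid of positive elements), with meet $\wedge$; there is a Garside element $\Delta\in P$ such that $[1,\Delta]=\{s:1\preccurlyeq s\preccurlyeq\Delta\}$ is finite and generates $G$ and $\Delta^{-1}P\Delta=P$; and $P$ is atomic. Elements of $[1,\Delta]$ are called simple; $q$ is a prefix of $x$ if $q\preccurlyeq x$. $\tau(x)=\Delta^{-1}x\Delta$. For simple $u$, $\partial(u)=u^{-1}\Delta$. Notation: $X^a=a^{-1}Xa$. Every $X\in G$ has a unique left normal form $X=\Delta^p x_1\cdots x_r$ where $p$ is maximal with $\Delta^p\preccurlyeq X$ and each $x_i\neq 1$ is the maximal simple prefix of $x_i\cdots x_r$; $\inf X=p$, $\sup X=p+r$, $\ell(X)=r$. Simple $a,b$ form a left weighted pair if $ab$ is in left normal form as written (equivalently $\partial(a)\wedge b=1$). Define $\iota(X)=\tau^{-p}(x_1)$, $\varphi(X)=x_r$ if $r>0$, and $\iota(\Delta^p)=1$, $\varphi(\Delta^p)=\Delta$. Cycling: $\mathbf c(X)=X^{\iota(X)}$. $SSS(X)$ is the set of conjugates of $X$ having maximal infimum and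 minimal supremum in the conjugacy class; $USS(X)$ is the set of $Y\in SSS(X)$ with $\mathbf c^m(Y)=Y$ for some $m>0$. For $Y\in USS(X)$, a minimal simple element for $Y$ (with respect to $USS(X)$) is a simple $s\neq1$ with $Y^s\in USS(X)$ such that no prefix $t\neq 1$, $t\neq s$ of $s$ satisfies $Y^t\in USS(X)$. *)

theory Defs
  imports "HOL-Algebra.Generated_Groups"
begin

text \<open>Garside groups, modelled in HOL-Algebra: a group G, the monoid of
positive elements P, and the Garside element D (Delta).\<close>

definition prefix :: "'a monoid \<Rightarrow> 'a set \<Rightarrow> 'a \<Rightarrow> 'a \<Rightarrow> bool" where
  "prefix G P a b \<longleftrightarrow> a \<in> carrier G \<and> b \<in> carrier G \<and> inv\<^bsub>G\<^esub> a \<otimes>\<^bsub>G\<^esub> b \<in> P"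

definition is_meet :: "'a monoid \<Rightarrow> 'a set \<Rightarrow> 'a \<Rightarrow> 'a \<Rightarrow> 'a \<Rightarrow> bool" where
  "is_meet G P a b m \<longleftrightarrow> m \<in> carrier G \<and> prefix G P m a \<and> prefix G P m b \<and>
     (\<forall>c \<in> carrier G. prefix G P c a \<and> prefix G P c b \<longrightarrow> prefix G P c m)"

definition is_join :: "'a monoid \<Rightarrow> 'a set \<Rightarrow> 'a \<Rightarrow> 'a \<Rightarrow> 'a \<Rightarrow> bool" where
  "is_join G P a b j \<longleftrightarrow> j \<in> carrier G \<and> prefix G P a j \<and> prefix G P b j \<and>
     (\<forall>c \<in> carrier G. prefix G P a c \<and> prefix G P b c \<longrightarrow> prefix G P j c)"

definition meet :: "'a monoid \<Rightarrow> 'a set \<Rightarrow> 'a \<Rightarrow> 'a \<Rightarrow> 'a" where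
  "meet G P a b = (THE m. is_meet G P a b m)"

definition simples :: "'a monoid \<Rightarrow> 'a set \<Rightarrow> 'a \<Rightarrow> 'a set" where
  "simples G P D = {s \<in> carrier G. prefix G P \<one>\<^bsub>G\<^esub> s \<and> prefix G P s D}"

definition prodl :: "'a monoid \<Rightarrow> 'a list \<Rightarrow> 'a" where
  "prodl G xs = foldr (\<lambda>x y. x \<otimes>\<^bsub>G\<^esub> y) xs \<one>\<^bsub>G\<^esub>"

definition garside_group :: "'a monoid \<Rightarrow> 'a set \<Rightarrow> 'a \<Rightarrow> bool" where
  "garside_group G P D \<longleftrightarrow>
     group G \<and> P \<subseteq> carrier G
     \<comment> \<open>P is a submonoid with P \<inter> P^{-1} = 1, so prefix is a partial order\<close>
     \<and> \<one>\<^bsub>G\<^esub> \<in> P \<and> (\<forall>a\<in>P. \<forall>b\<in>P. a \<otimes>\<^bsub>G\<^esub> b \<in> P)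
     \<and> (\<forall>a\<in>P. inv\<^bsub>G\<^esub> a \<in> P \<longrightarrow> a = \<one>\<^bsub>G\<^esub>)
     \<comment> \<open>lattice order\<close>
     \<and> (\<forall>a\<in>carrier G. \<forall>b\<in>carrier G. (\<exists>m. is_meet G P a b m) \<and> (\<exists>j. is_join G P a b j))
     \<comment> \<open>Garside element\<close>
     \<and> D \<in> P \<and> finite (simples G P D) \<and> generate G (simples G P D) = carrier G
     \<and> (\<lambda>p. inv\<^bsub>G\<^esub> D \<otimes>\<^bsub>G\<^esub> p \<otimes>\<^bsub>G\<^esub> D) ` P = P
     \<comment> \<open>atomicity\<close>
     \<and> (\<forall>x\<in>P. \<exists>N::nat. \<forall>xs. set xs \<subseteq> P - {\<one>\<^bsub>G\<^esub>} \<and> prodl G xs = x \<longrightarrow> length xs \<le> N)"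

definition Dpow :: "'a monoid \<Rightarrow> 'a \<Rightarrow> int \<Rightarrow> 'a" where
  "Dpow G D p = pow G D p"

definition is_lnf :: "'a monoid \<Rightarrow> 'a set \<Rightarrow> 'a \<Rightarrow> 'a \<Rightarrow> int \<Rightarrow> 'a list \<Rightarrow> bool" where
  "is_lnf G P D X p xs \<longleftrightarrow>
     X = Dpow G D p \<otimes>\<^bsub>G\<^esub> prodl G xs
     \<and> prefix G P (Dpow G D p) X
     \<and> (\<forall>q::int. prefix G P (Dpow G D q) X \<longrightarrow> q \<le> p)
     \<and> (\<forall>i < length xs. xs ! i \<noteq> \<one>\<^bsub>G\<^esub> \<and> xs ! i \<in> simples G P D
          \<and> prefix G P (xs ! i) (prodl G (drop i xs))
          \<and> (\<forall>t \<in> simples G P D. prefix G P t (prodl G (drop i xs)) \<longrightarrow> prefix G P t (xs ! i)))"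

definition lnf :: "'a monoid \<Rightarrow> 'a set \<Rightarrow> 'a \<Rightarrow> 'a \<Rightarrow> int \<times> 'a list" where
  "lnf G P D X = (THE (p, xs). is_lnf G P D X p xs)"

definition ginf :: "'a monoid \<Rightarrow> 'a set \<Rightarrow> 'a \<Rightarrow> 'a \<Rightarrow> int" where
  "ginf G P D X = fst (lnf G P D X)"

definition gsup :: "'a monoid \<Rightarrow> 'a set \<Rightarrow> 'a \<Rightarrow> 'a \<Rightarrow> int" where
  "gsup G P D X = fst (lnf G P D X) + int (length (snd (lnf G P D X)))"

definition conjg :: "'a monoid \<Rightarrow> 'a \<Rightarrow> 'a \<Rightarrow> 'a" where
  "conjg G X a = inv\<^bsub>G\<^esub> a \<otimes>\<^bsub>G\<^esub> X \<otimes>\<^bsub>G\<^esub> a"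

text \<open>iota(X) = tau^{-p}(x_1) = D^p x_1 D^{-p}; iota(D^p) = 1.\<close>
definition iota :: "'a monoid \<Rightarrow> 'a set \<Rightarrow> 'a \<Rightarrow> 'a \<Rightarrow> 'a" where
  "iota G P D X = (let (p, xs) = lnf G P D X in
     if xs = [] then \<one>\<^bsub>G\<^esub>
     else Dpow G D p \<otimes>\<^bsub>G\<^esub> hd xs \<otimes>\<^bsub>G\<^esub> Dpow G D (- p))"

definition phi :: "'a monoid \<Rightarrow> 'a set \<Rightarrow> 'a \<Rightarrow> 'a \<Rightarrow> 'a" where
  "phi G P D X = (let (p, xs) = lnf G P D X in if xs = [] then D else last xs)"

definition cycling :: "'a monoid \<Rightarrow> 'a set \<Rightarrow> 'a \<Rightarrow> 'a \<Rightarrow> 'a" where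
  "cycling G P D X = conjg G X (iota G P D X)"

definition conj_class :: "'a monoid \<Rightarrow> 'a \<Rightarrow> 'a set" where
  "conj_class G X = {conjg G X a | a. a \<in> carrier G}"

definition SSS :: "'a monoid \<Rightarrow> 'a set \<Rightarrow> 'a \<Rightarrow> 'a \<Rightarrow> 'a set" where
  "SSS G P D X = {Y \<in> conj_class G X. \<forall>Z \<in> conj_class G X.
      ginf G P D Z \<le> ginf G P D Y \<and> gsup G P D Y \<le> gsup G P D Z}"

definition USS :: "'a monoid \<Rightarrow> 'a set \<Rightarrow> 'a \<Rightarrow> 'a \<Rightarrow> 'a set" where
  "USS G P D X = {Y \<in> SSS G P D X. \<exists>m::nat. m > 0 \<and> (cycling G P D ^^ m) Y = Y}"

text \<open>Minimal simple element s for Y with respect to USS(X); prefixes of the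
simple element s are taken to be simple (positive) prefixes.\<close>
definition minimal_simple :: "'a monoid \<Rightarrow> 'a set \<Rightarrow> 'a \<Rightarrow> 'a \<Rightarrow> 'a \<Rightarrow> 'a \<Rightarrow> bool" where
  "minimal_simple G P D X Y s \<longleftrightarrow>
     s \<in> simples G P D \<and> s \<noteq> \<one>\<^bsub>G\<^esub> \<and> conjg G Y s \<in> USS G P D X \<and>
     (\<forall>t \<in> simples G P D. prefix G P t s \<and> t \<noteq> \<one>\<^bsub>G\<^esub> \<and> t \<noteq> s \<longrightarrow> conjg G Y t \<notin> USS G P D X)"

definition left_weighted :: "'a monoid \<Rightarrow> 'a set \<Rightarrow> 'a \<Rightarrow> 'a \<Rightarrow> 'a \<Rightarrow> bool" where
  "left_weighted G P D a b \<longleftrightarrow> a \<in> simples G P D \<and> b \<in> simples G P D \<and>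
     meet G P (inv\<^bsub>G\<^esub> a \<otimes>\<^bsub>G\<^esub> D) b = \<one>\<^bsub>G\<^esub>"

end

theory Submission
  imports Defs
begin

text \<open>
  Let \<open>p = inf X\<close> and \<open>q = sup X\<close>. Then \<open>\<iota>(X)\<close> is the meet of \<open>X \<Delta>^-p\<close> and \<open>\<Delta>\<close>, and
  \<open>B = \<partial>(\<phi>(X))\<close> is the meet of \<open>X^-1 \<Delta>^q\<close> and \<open>\<Delta>\<close>. With these formulas conjugation by
  \<open>\<iota>\<close> (cycling) visibly commutes with conjugation by \<open>\<partial>(\<phi>)\<close> (decycling followed by \<open>\<tau>\<close>), so
  \<open>X^B\<close> is again in the ultra summit set. They also show that the transport
  \<open>a \<mapsto> \<iota>(X)^-1 a \<iota>(X^a)\<close> along cycling preserves meets; as it acts on simple elements, it is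
  recurrent on those conjugating \<open>X\<close> into the ultra summit set, which are therefore closed under
  meets. So the meet of \<open>B\<close> and \<open>s\<close> conjugates \<open>X\<close> into the ultra summit set, and by minimality
  of \<open>s\<close> it is \<open>1\<close> (the pair is left weighted) or \<open>s\<close> (the product is simple).
\<close>

section \<open>The lattice order of a Garside group and the powers of Delta\<close>

locale garside_structure =
  fixes G (structure) and P :: "'a set" and D :: 'a
  assumes garside: "garside_group G P D"
    and D_neq_one: "D \<noteq> \<one>"
begin

sublocale group G
  using garside by (simp add: garside_group_def)

abbreviation le (infix "\<preceq>" 50) where "a \<preceq> b \<equiv> prefix G P a b"
abbreviation glb (infixl "\<curlywedge>" 65) where "a \<curlywedge> b \<equiv> meet G P a b"
abbreviation dp where "dp k \<equiv> Dpow G D k"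
abbreviation S where "S \<equiv> simples G P D"
abbreviation conjugate where "conjugate \<equiv> conjg G"

lemma P_closed [simp]: "a \<in> P \<Longrightarrow> a \<in> carrier G"
  and one_P [simp]: "\<one> \<in> P"
  and mult_P [simp]: "a \<in> P \<Longrightarrow> b \<in> P \<Longrightarrow> a \<otimes> b \<in> P"
  and P_inv_P: "a \<in> P \<Longrightarrow> inv a \<in> P \<Longrightarrow> a = \<one>"
  and D_P [simp]: "D \<in> P"
  and finite_simples: "finite S"
  and generate_simples: "generate G S = carrier G"
  and conj_D_image: "(\<lambda>p. inv D \<otimes> p \<otimes> D) ` P = P"
  and ex_meet: "a \<in> carrier G \<Longrightarrow> b \<in> carrier G \<Longrightarrow> \<exists>m. is_meet G P a b m"
  using garside unfolding garside_group_def by auto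

lemma inv_cancel_left [simp]:
  "a \<in> carrier G \<Longrightarrow> b \<in> carrier G \<Longrightarrow> inv a \<otimes> (a \<otimes> b) = b"
  "a \<in> carrier G \<Longrightarrow> b \<in> carrier G \<Longrightarrow> a \<otimes> (inv a \<otimes> b) = b"
  by (simp_all flip: m_assoc)

lemma dp_closed [simp]: "dp k \<in> carrier G"
  by (simp add: Dpow_def)

lemma dp_0 [simp]: "dp 0 = \<one>" and dp_1 [simp]: "dp 1 = D"
  by (simp_all add: Dpow_def)

lemma dp_mult: "dp j \<otimes> dp k = dp (j + k)"
  by (simp add: Dpow_def int_pow_mult)

lemma dp_mult_left: "a \<in> carrier G \<Longrightarrow> dp j \<otimes> (dp k \<otimes> a) = dp (j + k) \<otimes> a"
  by (simp add: dp_mult flip: m_assoc)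

lemma dp_inv: "inv (dp k) = dp (- k)"
  by (simp add: Dpow_def int_pow_neg)

lemma dp_D: "dp k \<otimes> D = dp (k + 1)"
  using dp_mult[of k 1] by simp

lemma D_dp: "D \<otimes> dp k = dp (1 + k)"
  using dp_mult[of 1 k] by simp

lemma D_dp_left: "a \<in> carrier G \<Longrightarrow> D \<otimes> (dp k \<otimes> a) = dp (1 + k) \<otimes> a"
  using dp_mult_left[of a 1 k] by simp

lemma dp_D_left: "a \<in> carrier G \<Longrightarrow> dp k \<otimes> (D \<otimes> a) = dp (k + 1) \<otimes> a"
  using dp_mult_left[of a k 1] by simp

lemma le_carrier: assumes "a \<preceq> b" shows "a \<in> carrier G" "b \<in> carrier G"
  using assms by (auto simp: prefix_def)

lemma le_refl [simp]: "a \<in> carrier G \<Longrightarrow> a \<preceq> a"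
  by (simp add: prefix_def)

lemma le_trans: assumes "a \<preceq> b" "b \<preceq> c" shows "a \<preceq> c"
proof -
  have "inv a \<otimes> c = (inv a \<otimes> b) \<otimes> (inv b \<otimes> c)"
    using assms by (auto simp: prefix_def m_assoc)
  then show ?thesis using assms by (auto simp: prefix_def)
qed

lemma le_antisym: assumes "a \<preceq> b" "b \<preceq> a" shows "a = b"
proof -
  have C: "a \<in> carrier G" "b \<in> carrier G" using assms le_carrier by auto
  have "inv (inv a \<otimes> b) = inv b \<otimes> a" using C by (simp add: inv_mult_group)
  then have "inv a \<otimes> b = \<one>" using assms P_inv_P by (auto simp: prefix_def)
  then show ?thesis using C by (metis inv_cancel_left(2) r_one)
qed

lemma one_le_iff: "\<one> \<preceq> a \<longleftrightarrow> a \<in> P"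
  by (auto simp: prefix_def)

lemma mult_left_le_iff [simp]:
  "g \<in> carrier G \<Longrightarrow> a \<in> carrier G \<Longrightarrow> b \<in> carrier G \<Longrightarrow> g \<otimes> a \<preceq> g \<otimes> b \<longleftrightarrow> a \<preceq> b"
  by (simp add: prefix_def inv_mult_group m_assoc)

lemma le_mult_pos: "a \<in> carrier G \<Longrightarrow> b \<in> P \<Longrightarrow> a \<preceq> a \<otimes> b"
  by (simp add: prefix_def)

lemma conj_D_P:
  assumes "a \<in> P" shows "inv D \<otimes> a \<otimes> D \<in> P" "D \<otimes> a \<otimes> inv D \<in> P"
proof -
  show "inv D \<otimes> a \<otimes> D \<in> P" using assms conj_D_image by blast
  obtain b where "b \<in> P" "a = inv D \<otimes> b \<otimes> D" using assms conj_D_image by blast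
  then show "D \<otimes> a \<otimes> inv D \<in> P" by (simp add: m_assoc)
qed

text \<open>Induction from \<open>0\<close> in both directions: the upward step uses invariance of
  \<open>P\<close> under conjugation by \<open>D\<close>, the downward step invariance under
  conjugation by its inverse.\<close>

lemma conj_dp_P: "a \<in> P \<Longrightarrow> dp (- k) \<otimes> a \<otimes> dp k \<in> P"
proof (induction k rule: int_induct[where k = 0])
  case base then show ?case by simp
next
  case (step1 k)
  have "dp (- 1 - k) = dp (- k - 1)" by (rule arg_cong) simp
  then have "inv D \<otimes> (dp (- k) \<otimes> a \<otimes> dp k) \<otimes> D = dp (- (k + 1)) \<otimes> a \<otimes> dp (k + 1)"
    using step1.prems dp_inv[of 1]
    by (simp add: m_assoc dp_mult dp_mult_left dp_D)
  then show ?case using conj_D_P(1)[OF step1.IH] step1.prems by simp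
next
  case (step2 k)
  have "D \<otimes> (dp (- k) \<otimes> a \<otimes> dp k) \<otimes> inv D = dp (- (k - 1)) \<otimes> a \<otimes> dp (k - 1)"
    using step2.prems dp_inv[of 1] by (simp add: m_assoc dp_mult D_dp_left)
  then show ?case using conj_D_P(2)[OF step2.IH] step2.prems by simp
qed

text \<open>The order is invariant under left multiplication by definition. Right multiplication by
  a power of Delta also preserves it, because conjugation by that power preserves
  \<open>P\<close>.\<close>

lemma le_mult_dp_iff [simp]:
  assumes "a \<in> carrier G" "b \<in> carrier G"
  shows "a \<otimes> dp k \<preceq> b \<otimes> dp k \<longleftrightarrow> a \<preceq> b"
proof -
  have *: "a \<otimes> dp k \<preceq> b \<otimes> dp k"
    if "a \<preceq> b" "a \<in> carrier G" "b \<in> carrier G" for a b k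
    using that conj_dp_P[of "inv a \<otimes> b" k]
    by (simp add: prefix_def inv_mult_group dp_inv m_assoc)
  show ?thesis using *[of a b k] *[of "a \<otimes> dp k" "b \<otimes> dp k" "- k"] assms
    by (auto simp: m_assoc dp_mult)
qed

lemma le_mult_D_iff [simp]:
  "a \<in> carrier G \<Longrightarrow> b \<in> carrier G \<Longrightarrow> a \<otimes> D \<preceq> b \<otimes> D \<longleftrightarrow> a \<preceq> b"
  using le_mult_dp_iff[of a b 1] by simp

lemma dp_nonneg: "0 \<le> k \<Longrightarrow> dp k \<in> P"
proof (induction k rule: int_ge_induct)
  case base then show ?case by simp
next
  case (step k)
  then show ?case using mult_P[of "dp k" D] by (simp add: dp_D)
qed

text \<open>This is where \<open>D_neq_one\<close> enters. If a negative power were positive,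
  multiplying it by a nonnegative power would make the inverse of \<open>D\<close> positive, forcing
  \<open>D\<close> to be trivial.\<close>

lemma dp_P_iff [simp]: "dp k \<in> P \<longleftrightarrow> 0 \<le> k"
proof
  assume k: "dp k \<in> P"
  show "0 \<le> k"
  proof (rule ccontr)
    assume "\<not> 0 \<le> k"
    then have "dp (- k - 1) \<in> P" by (intro dp_nonneg) auto
    then have "dp k \<otimes> dp (- k - 1) \<in> P" using k by simp
    then have "inv D \<in> P" using dp_inv[of 1] by (simp add: dp_mult)
    then show False using P_inv_P[of D] D_neq_one by simp
  qed
qed (rule dp_nonneg)

lemma dp_le_iff [simp]: "dp j \<preceq> dp k \<longleftrightarrow> j \<le> k"
  by (simp add: prefix_def dp_inv dp_mult)

lemma is_meet_glb:
  assumes "a \<in> carrier G" "b \<in> carrier G" shows "is_meet G P a b (a \<curlywedge> b)"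
proof -
  obtain m where m: "is_meet G P a b m" using ex_meet assms by blast
  have "n = m" if "is_meet G P a b n" for n
    using m that le_antisym unfolding is_meet_def by blast
  then show ?thesis unfolding meet_def using m by (metis theI)
qed

lemma glb_closed [simp]: "a \<in> carrier G \<Longrightarrow> b \<in> carrier G \<Longrightarrow> a \<curlywedge> b \<in> carrier G"
  and glb_le1: "a \<in> carrier G \<Longrightarrow> b \<in> carrier G \<Longrightarrow> a \<curlywedge> b \<preceq> a"
  and glb_le2: "a \<in> carrier G \<Longrightarrow> b \<in> carrier G \<Longrightarrow> a \<curlywedge> b \<preceq> b"
  using is_meet_glb unfolding is_meet_def by blast+

lemma le_glb_iff:
  "a \<in> carrier G \<Longrightarrow> b \<in> carrier G \<Longrightarrow> c \<preceq> a \<curlywedge> b \<longleftrightarrow> c \<preceq> a \<and> c \<preceq> b"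
  using is_meet_glb[of a b] le_carrier le_trans unfolding is_meet_def by blast

text \<open>Identities between meets are proved by comparing lower bounds: \<open>le_glb_iff\<close>
  turns them into propositional logic, so no rearranging of nested meets is required.\<close>

lemma eq_by_lower_bounds:
  assumes "a \<in> carrier G" "b \<in> carrier G"
    and "\<And>c. c \<in> carrier G \<Longrightarrow> c \<preceq> a \<longleftrightarrow> c \<preceq> b"
  shows "a = b"
  using assms le_antisym le_refl by blast

lemma mult_le_iff:
  assumes "g \<in> carrier G" "c \<in> carrier G" "a \<in> carrier G"
  shows "c \<preceq> g \<otimes> a \<longleftrightarrow> inv g \<otimes> c \<preceq> a"
  using mult_left_le_iff[of g "inv g \<otimes> c" a] assms by simp

lemma le_mult_dp_move:
  assumes "c \<in> carrier G" "a \<in> carrier G"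
  shows "c \<preceq> a \<otimes> dp k \<longleftrightarrow> c \<otimes> dp (- k) \<preceq> a"
  using le_mult_dp_iff[of "c \<otimes> dp (- k)" a k] assms by (simp add: m_assoc dp_mult)

lemma mult_glb:
  assumes "g \<in> carrier G" "a \<in> carrier G" "b \<in> carrier G"
  shows "g \<otimes> (a \<curlywedge> b) = (g \<otimes> a) \<curlywedge> (g \<otimes> b)"
  by (rule eq_by_lower_bounds) (use assms in \<open>simp_all add: mult_le_iff le_glb_iff\<close>)

lemma glb_mult_dp:
  assumes "a \<in> carrier G" "b \<in> carrier G"
  shows "(a \<curlywedge> b) \<otimes> dp k = (a \<otimes> dp k) \<curlywedge> (b \<otimes> dp k)"
  by (rule eq_by_lower_bounds) (use assms in \<open>simp_all add: le_mult_dp_move le_glb_iff\<close>)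

lemma glb_mult_D:
  "a \<in> carrier G \<Longrightarrow> b \<in> carrier G \<Longrightarrow> (a \<curlywedge> b) \<otimes> D = (a \<otimes> D) \<curlywedge> (b \<otimes> D)"
  using glb_mult_dp[of a b 1] by simp

lemma glb_absorb1: assumes "a \<preceq> b" shows "a \<curlywedge> b = a"
  using assms le_carrier[OF assms]
  by (intro eq_by_lower_bounds) (auto simp: le_glb_iff intro: le_trans)

lemma glb_commute: "a \<in> carrier G \<Longrightarrow> b \<in> carrier G \<Longrightarrow> a \<curlywedge> b = b \<curlywedge> a"
  by (rule eq_by_lower_bounds) (auto simp: le_glb_iff)

lemma simples_iff: "s \<in> S \<longleftrightarrow> s \<in> P \<and> s \<preceq> D"
  by (auto simp: simples_def one_le_iff)

lemma simples_closed [simp]: "s \<in> S \<Longrightarrow> s \<in> carrier G"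
  by (simp add: simples_iff)

lemma D_simple: "D \<in> S"
  by (simp add: simples_iff)

lemma glb_P: "a \<in> P \<Longrightarrow> b \<in> P \<Longrightarrow> a \<curlywedge> b \<in> P"
  using le_glb_iff[of a b \<one>] by (simp add: one_le_iff)

lemma glb_simple: "a \<in> P \<Longrightarrow> b \<in> S \<Longrightarrow> a \<curlywedge> b \<in> S"
  using le_trans[OF glb_le2[of a b], of D] glb_P by (auto simp: simples_iff)

section \<open>Left normal forms\<close>

text \<open>The condition on the factors in \<open>is_lnf\<close>, separated from the power of Delta
  so that it can be studied by list induction.\<close>

definition normal_word :: "'a list \<Rightarrow> bool" where
  "normal_word xs \<longleftrightarrow> (\<forall>i < length xs. xs ! i \<noteq> \<one> \<and> xs ! i \<in> S
          \<and> xs ! i \<preceq> prodl G (drop i xs)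
          \<and> (\<forall>t \<in> S. t \<preceq> prodl G (drop i xs) \<longrightarrow> t \<preceq> xs ! i))"

lemma prodl_simps [simp]: "prodl G [] = \<one>" "prodl G (x # xs) = x \<otimes> prodl G xs"
  by (simp_all add: prodl_def)

lemma normal_word_Nil [simp]: "normal_word []"
  by (simp add: normal_word_def)

lemma prodl_P: "set xs \<subseteq> P \<Longrightarrow> prodl G xs \<in> P"
  by (induction xs) auto

lemma normal_word_set: "normal_word xs \<Longrightarrow> set xs \<subseteq> S"
  by (auto simp: normal_word_def in_set_conv_nth)

lemma normal_word_prodl_P: "normal_word xs \<Longrightarrow> prodl G xs \<in> P"
  using normal_word_set prodl_P simples_iff by blast

text \<open>Recursive form of the greedy condition. The product is positive, so its meet with
  \<open>D\<close> is itself simple and is therefore the maximal simple prefix.\<close>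

lemma normal_word_Cons: "normal_word (x # xs) \<longleftrightarrow>
  x \<in> P \<and> x \<noteq> \<one> \<and> normal_word xs \<and> x = prodl G (x # xs) \<curlywedge> D"
proof -
  let ?Z = "prodl G (x # xs)"
  have unfold: "normal_word (x # xs) \<longleftrightarrow> normal_word xs \<and> x \<noteq> \<one> \<and> x \<in> S \<and> x \<preceq> ?Z
    \<and> (\<forall>t \<in> S. t \<preceq> ?Z \<longrightarrow> t \<preceq> x)"
    unfolding normal_word_def
    by (simp add: All_less_Suc2) blast
  have "x \<in> S \<and> x \<preceq> ?Z \<and> (\<forall>t \<in> S. t \<preceq> ?Z \<longrightarrow> t \<preceq> x) \<longleftrightarrow> x \<in> P \<and> x = ?Z \<curlywedge> D"
    if "normal_word xs"
  proof -
    have W: "prodl G xs \<in> P" using that by (rule normal_word_prodl_P)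
    show ?thesis
    proof (intro iffI conjI)
      assume x: "x \<in> S \<and> x \<preceq> ?Z \<and> (\<forall>t \<in> S. t \<preceq> ?Z \<longrightarrow> t \<preceq> x)"
      then show "x \<in> P" by (simp add: simples_iff)
      then have Z: "?Z \<in> P" using W by simp
      have "?Z \<curlywedge> D \<in> S" using Z D_simple by (rule glb_simple)
      moreover have "?Z \<curlywedge> D \<preceq> ?Z" using Z by (intro glb_le1) auto
      ultimately have "?Z \<curlywedge> D \<preceq> x" using x by blast
      moreover have "x \<preceq> ?Z \<curlywedge> D" using x Z by (simp add: le_glb_iff simples_iff)
      ultimately show "x = ?Z \<curlywedge> D" by (rule le_antisym[rotated])
    next
      assume x: "x \<in> P \<and> x = ?Z \<curlywedge> D"
      then have Z: "?Z \<in> carrier G" using W by simp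
      have *: "c \<preceq> x \<longleftrightarrow> c \<preceq> ?Z \<and> c \<preceq> D" for c
        using le_glb_iff[OF Z, of D c] x by simp
      have "x \<preceq> x" using x by simp
      then show "x \<in> S" "x \<preceq> ?Z" "\<forall>t \<in> S. t \<preceq> ?Z \<longrightarrow> t \<preceq> x"
        using * x by (auto simp: simples_iff)
    qed
  qed
  then show ?thesis using unfold by blast
qed

lemma pos_le_one: assumes "a \<in> P" "a \<preceq> \<one>" shows "a = \<one>"
  using assms le_antisym one_le_iff by blast

lemma normal_word_prodl_one: assumes "normal_word xs" "prodl G xs = \<one>" shows "xs = []"
proof (cases xs)
  case (Cons x ys)
  then have x: "x \<in> P" "x \<noteq> \<one>" "normal_word ys" using assms by (auto simp: normal_word_Cons)
  then have "x \<preceq> \<one>"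
    using le_mult_pos[of x "prodl G ys"] assms Cons normal_word_prodl_P by simp
  then show ?thesis using x pos_le_one by blast
qed

lemma normal_word_inject:
  "normal_word xs \<Longrightarrow> normal_word ys \<Longrightarrow> prodl G xs = prodl G ys \<Longrightarrow> xs = ys"
proof (induction xs arbitrary: ys)
  case Nil
  then show ?case using normal_word_prodl_one[of ys] by simp
next
  case (Cons x xs)
  obtain y zs where ys: "ys = y # zs"
    using normal_word_prodl_one[of "x # xs"] Cons.prems by (cases ys) auto
  have "x = prodl G (x # xs) \<curlywedge> D" "y = prodl G (y # zs) \<curlywedge> D"
    using Cons.prems ys normal_word_Cons by blast+
  then have "x = y" using Cons.prems(3) ys by simp
  moreover have "normal_word xs" "normal_word zs" "x \<in> P"
    using Cons.prems ys by (auto simp: normal_word_Cons)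
  moreover from this have "prodl G xs = prodl G zs"
    using Cons.prems(3) ys \<open>x = y\<close> normal_word_prodl_P by simp
  ultimately show ?case using Cons.IH ys by blast
qed

text \<open>Removing the maximal simple prefix lowers the upper bound by one: \<open>Z\<close> lies
  below both \<open>Z \<otimes> dp k\<close> and \<open>dp (k + 1)\<close>, hence below their meet
  \<open>(Z \<curlywedge> D) \<otimes> dp k\<close>.\<close>

lemma quotient_glb_D_le:
  assumes Z: "Z \<in> carrier G" "Z \<preceq> dp (k + 1)" and k: "0 \<le> k"
  shows "inv (Z \<curlywedge> D) \<otimes> Z \<preceq> dp k"
proof -
  have "Z \<preceq> Z \<otimes> dp k" using Z k by (simp add: le_mult_pos)
  then have "Z \<preceq> (Z \<curlywedge> D) \<otimes> dp k"
    using Z by (simp add: glb_mult_dp le_glb_iff D_dp add.commute)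
  then show ?thesis using Z by (simp add: mult_le_iff)
qed

lemma normal_word_exists:
  "Z \<in> P \<Longrightarrow> Z \<preceq> dp (int k) \<Longrightarrow> \<exists>xs. normal_word xs \<and> prodl G xs = Z"
proof (induction k arbitrary: Z)
  case 0
  then show ?case using pos_le_one[of Z] by (intro exI[of _ "[]"]) simp
next
  case (Suc k)
  define x where "x = Z \<curlywedge> D"
  have xC: "x \<in> carrier G" using Suc.prems by (simp add: x_def)
  have xP: "x \<in> P" using Suc.prems by (simp add: x_def glb_P)
  have "inv x \<otimes> Z \<preceq> dp (int k)"
    using Suc.prems quotient_glb_D_le[of Z "int k"] by (simp add: x_def add.commute)
  moreover have "inv x \<otimes> Z \<in> P"
    using glb_le1[of Z D] Suc.prems by (simp add: x_def prefix_def)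
  ultimately obtain xs where xs: "normal_word xs" "prodl G xs = inv x \<otimes> Z"
    using Suc.IH by blast
  show ?case
  \<comment> \<open>With a trivial prefix the quotient is \<open>Z\<close> itself, so the word from
    the induction hypothesis already serves and no letter is added.\<close>
  proof (cases "x = \<one>")
    case True
    then show ?thesis using xs Suc.prems by auto
  next
    case False
    have Z: "prodl G (x # xs) = Z" using xs xC Suc.prems by simp
    then have "normal_word (x # xs)"
      unfolding normal_word_Cons using xs xP False x_def by simp
    then show ?thesis using Z by blast
  qed
qed

text \<open>Together with \<open>prodl_le_dp\<close> this identifies the length of a normal word
  with the least exponent bounding its product.\<close>

lemma normal_word_length_le:
  "normal_word xs \<Longrightarrow> prodl G xs \<preceq> dp (int k) \<Longrightarrow> length xs \<le> k"
proof (induction xs arbitrary: k)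
  case (Cons x xs)
  have x: "x \<in> P" "x \<noteq> \<one>" "normal_word xs" "(x \<otimes> prodl G xs) \<curlywedge> D = x"
    using Cons.prems by (simp_all add: normal_word_Cons)
  have W: "prodl G xs \<in> P" using x normal_word_prodl_P by simp
  show ?case
  proof (cases k)
    case 0
    then have "prodl G (x # xs) = \<one>"
      using Cons.prems normal_word_prodl_P pos_le_one by (metis dp_0 of_nat_0)
    then show ?thesis using Cons.prems normal_word_prodl_one by blast
  next
    case (Suc j)
    then have "prodl G xs \<preceq> dp (int j)"
      using quotient_glb_D_le[of "x \<otimes> prodl G xs" "int j"] Cons.prems x W
      by (simp add: add.commute)
    then show ?thesis using Cons.IH x Suc by simp
  qed
qed simp

lemma prodl_le_dp: "set xs \<subseteq> S \<Longrightarrow> prodl G xs \<preceq> dp (int (length xs))"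
proof (induction xs)
  case (Cons x xs)
  then have W: "prodl G xs \<in> carrier G" using le_carrier by auto
  have x: "x \<in> carrier G" "x \<preceq> D" using Cons.prems by (auto simp: simples_iff)
  have "x \<otimes> prodl G xs \<preceq> x \<otimes> dp (int (length xs))" using Cons W x by simp
  also have "x \<otimes> dp (int (length xs)) \<preceq> D \<otimes> dp (int (length xs))" using x by simp
  finally (le_trans) show ?case by (simp add: D_dp)
qed simp

text \<open>The complement of the last factor is the first factor of the normal form of the inverse.\<close>
lemma inv_last_mult_D:
  "normal_word xs \<Longrightarrow> xs \<noteq> [] \<Longrightarrow>
    inv (last xs) \<otimes> D = (inv (prodl G xs) \<otimes> dp (int (length xs))) \<curlywedge> D"
proof (induction xs)
  case (Cons x xs)
  have x: "x \<in> P" "x \<noteq> \<one>" "normal_word xs" "(x \<otimes> prodl G xs) \<curlywedge> D = x"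
    using Cons.prems by (simp_all add: normal_word_Cons)
  show ?case
  proof (cases "xs = []")
    case True
    have "inv x \<otimes> D \<preceq> D"
      using conj_D_P(1)[OF x(1)] x(1) by (simp add: prefix_def inv_mult_group m_assoc)
    then show ?thesis using True x by (simp add: glb_absorb1)
  next
    case False
    define W where "W = prodl G xs"
    define n where "n = int (length xs)"
    have W: "W \<in> P" using x normal_word_prodl_P by (simp add: W_def)
    \<comment> \<open>Maximality of \<open>x\<close>, after cancelling \<open>x\<close> on the left:
      the complement of \<open>x\<close> has no common positive prefix with the remaining product
      \<open>W\<close>.\<close>
    have "inv x \<otimes> x = inv x \<otimes> ((x \<otimes> W) \<curlywedge> D)" using x by (simp add: W_def)
    then have one: "W \<curlywedge> (inv x \<otimes> D) = \<one>" using x W by (simp add: mult_glb)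
    have n: "1 \<le> n" using False by (cases xs) (auto simp: n_def)
    have eq: "dp n = (W \<otimes> dp n) \<curlywedge> (inv x \<otimes> dp (n + 1))"
      using glb_mult_dp[of W "inv x \<otimes> D" n] one W x by (simp add: m_assoc D_dp add.commute)
    \<comment> \<open>As \<open>n\<close> is at least 1, the constraint
      \<open>W \<otimes> dp n\<close> holds for everything below \<open>W \<otimes> D\<close>.
      Meeting \<open>eq\<close> with \<open>W \<otimes> D\<close> thus drops it; cancelling
      \<open>W\<close> shows that prepending \<open>x\<close> leaves the right-hand side
      unchanged.\<close>
    have WD: "W \<otimes> D \<preceq> W \<otimes> dp n"
      using W n dp_le_iff[of 1 n] by simp
    have "(dp n) \<curlywedge> (W \<otimes> D) = (inv x \<otimes> dp (n + 1)) \<curlywedge> (W \<otimes> D)"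
    proof (rule eq_by_lower_bounds)
      fix c
      have "c \<preceq> dp n \<longleftrightarrow> c \<preceq> W \<otimes> dp n \<and> c \<preceq> inv x \<otimes> dp (n + 1)"
        by (subst eq) (use W x in \<open>simp add: le_glb_iff\<close>)
      then show "c \<preceq> (dp n) \<curlywedge> (W \<otimes> D) \<longleftrightarrow> c \<preceq> (inv x \<otimes> dp (n + 1)) \<curlywedge> (W \<otimes> D)"
        using WD le_trans[OF _ WD] W x by (auto simp: le_glb_iff)
    qed (use W x in auto)
    then have "inv W \<otimes> ((dp n) \<curlywedge> (W \<otimes> D)) = inv W \<otimes> ((inv x \<otimes> dp (n + 1)) \<curlywedge> (W \<otimes> D))"
      by simp
    then have "(inv W \<otimes> dp n) \<curlywedge> D = (inv (x \<otimes> W) \<otimes> dp (n + 1)) \<curlywedge> D"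
      using W x by (simp add: mult_glb inv_mult_group m_assoc)
    then show ?thesis using Cons.IH x False by (simp add: W_def n_def add.commute)
  qed
qed simp

section \<open>Existence and uniqueness of the normal form, infimum and supremum\<close>

lemma inv_le_dp: assumes "Y \<in> carrier G" shows "inv Y \<preceq> dp (- k) \<longleftrightarrow> dp k \<preceq> Y"
proof -
  have "inv Y \<preceq> dp (- k) \<longleftrightarrow> \<one> \<preceq> Y \<otimes> dp (- k)"
    using assms by (simp add: prefix_def)
  then show ?thesis using assms by (simp add: le_mult_dp_move)
qed

text \<open>The simple elements generate the group and lie between two powers of Delta; such bounds
  pass to inverses and add up under products.\<close>

lemma dp_bounds:
  assumes "Y \<in> carrier G" shows "\<exists>p q. dp p \<preceq> Y \<and> Y \<preceq> dp q"
proof -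
  have "Y \<in> generate G S" using assms generate_simples by simp
  then show ?thesis
  proof induction
    case one
    have "dp 0 \<preceq> \<one> \<and> \<one> \<preceq> dp 0" by simp
    then show ?case by blast
  next
    case (incl h)
    then have "dp 0 \<preceq> h \<and> h \<preceq> dp 1" by (simp add: simples_iff one_le_iff)
    then show ?case by blast
  next
    case (inv h)
    then have "dp (- 1) \<preceq> inv h \<and> inv h \<preceq> dp (- 0)"
      using inv_le_dp[of h 0] inv_le_dp[of "inv h" "-1"] by (simp add: simples_iff one_le_iff)
    then show ?case by blast
  next
    case (eng a b)
    then obtain p q p' q' where *: "dp p \<preceq> a" "a \<preceq> dp q" "dp p' \<preceq> b" "b \<preceq> dp q'" by blast
    then have C: "a \<in> carrier G" "b \<in> carrier G" using le_carrier by auto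
    have "dp p \<otimes> dp p' \<preceq> a \<otimes> dp p'" "a \<otimes> dp p' \<preceq> a \<otimes> b"
      "a \<otimes> b \<preceq> a \<otimes> dp q'" "a \<otimes> dp q' \<preceq> dp q \<otimes> dp q'"
      using * C by auto
    then have "dp (p + p') \<preceq> a \<otimes> b \<and> a \<otimes> b \<preceq> dp (q + q')"
      unfolding dp_mult using le_trans by blast
    then show ?case by blast
  qed
qed

lemma is_lnf_iff: "is_lnf G P D Y p xs \<longleftrightarrow>
  Y = dp p \<otimes> prodl G xs \<and> dp p \<preceq> Y \<and> (\<forall>q. dp q \<preceq> Y \<longrightarrow> q \<le> p) \<and> normal_word xs"
  by (simp add: is_lnf_def normal_word_def)

lemma is_lnf_exists:
  assumes Y: "Y \<in> carrier G" shows "\<exists>p xs. is_lnf G P D Y p xs"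
proof -
  obtain p0 q where pq: "dp p0 \<preceq> Y" "Y \<preceq> dp q" using dp_bounds Y by blast
  have bound: "k \<le> q" if "dp k \<preceq> Y" for k
    using le_trans[OF that pq(2)] by simp
  \<comment> \<open>Only exponents between \<open>p0\<close> and \<open>q\<close> are collected, so
    that the set is finite and \<open>Max\<close> is meaningful.\<close>
  define p where "p = Max {k \<in> {p0..q}. dp k \<preceq> Y}"
  have fin: "finite {k \<in> {p0..q}. dp k \<preceq> Y}" by (rule finite_Collect_conjI) simp
  have ne: "p0 \<in> {k \<in> {p0..q}. dp k \<preceq> Y}" using pq bound by simp
  have p: "dp p \<preceq> Y" using Max_in[OF fin] ne unfolding p_def by blast
  have max: "k \<le> p" if "dp k \<preceq> Y" for k
  proof (cases "p0 \<le> k")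
    case True
    then show ?thesis using Max_ge[OF fin] that bound unfolding p_def by simp
  next
    case False
    then show ?thesis using Max_ge[OF fin ne] unfolding p_def by linarith
  qed
  have "dp (- p) \<otimes> Y \<in> P" using p by (simp add: prefix_def dp_inv)
  moreover have "dp (- p) \<otimes> Y \<preceq> dp (int (nat (q - p)))"
    using pq(2) p bound[OF p] mult_le_iff[of "dp p" Y "dp (q - p)"] Y by (simp add: dp_mult dp_inv)
  ultimately obtain xs where "normal_word xs" "prodl G xs = dp (- p) \<otimes> Y"
    using normal_word_exists by blast
  then have "is_lnf G P D Y p xs"
    using Y p max by (simp add: is_lnf_iff dp_mult_left)
  then show ?thesis by blast
qed

lemma is_lnf_unique:
  assumes "is_lnf G P D Y p xs" "is_lnf G P D Y q ys"
  shows "q = p \<and> ys = xs"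
proof -
  have "q = p" using assms unfolding is_lnf_iff by (meson order_antisym)
  moreover have "prodl G ys = prodl G xs"
    using assms \<open>q = p\<close> normal_word_prodl_P unfolding is_lnf_iff
    by (metis P_closed dp_closed inv_cancel_left(1))
  ultimately show ?thesis using assms normal_word_inject unfolding is_lnf_iff by blast
qed

lemma lnf_eq: assumes "is_lnf G P D Y p xs" shows "lnf G P D Y = (p, xs)"
  unfolding lnf_def using assms is_lnf_unique by (intro the_equality) blast+

lemma lnf_cases:
  assumes "Y \<in> carrier G"
  obtains p xs where "lnf G P D Y = (p, xs)" "Y = dp p \<otimes> prodl G xs" "dp p \<preceq> Y"
    "\<And>q. dp q \<preceq> Y \<Longrightarrow> q \<le> p" "normal_word xs" "prodl G xs \<in> P"
  using is_lnf_exists[OF assms] lnf_eq is_lnf_iff normal_word_prodl_P by metis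

text \<open>With \<open>gsup_le_iff\<close>, this lets bounds on infimum and supremum be handled as
  plain order inequalities.\<close>

lemma le_ginf_iff: assumes Y: "Y \<in> carrier G" shows "k \<le> ginf G P D Y \<longleftrightarrow> dp k \<preceq> Y"
proof -
  obtain p where "ginf G P D Y = p" "dp p \<preceq> Y" "\<And>q. dp q \<preceq> Y \<Longrightarrow> q \<le> p"
    using lnf_cases[OF Y] unfolding ginf_def by (metis fst_conv)
  then show ?thesis using le_trans dp_le_iff by blast
qed

lemma gsup_le_iff: assumes Y: "Y \<in> carrier G" shows "gsup G P D Y \<le> k \<longleftrightarrow> Y \<preceq> dp k"
proof -
  obtain p xs where n: "lnf G P D Y = (p, xs)" "Y = dp p \<otimes> prodl G xs" "dp p \<preceq> Y"
    "normal_word xs" "prodl G xs \<in> P" using lnf_cases[OF Y] by metis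
  have shift: "Y \<preceq> dp k \<longleftrightarrow> prodl G xs \<preceq> dp (k - p)"
    using n mult_left_le_iff[of "dp p" "prodl G xs" "dp (k - p)"] by (simp add: dp_mult)
  have "int (length xs) \<le> k - p \<longleftrightarrow> prodl G xs \<preceq> dp (k - p)"
  proof
    assume "int (length xs) \<le> k - p"
    then show "prodl G xs \<preceq> dp (k - p)"
      using le_trans[OF prodl_le_dp[OF normal_word_set[OF n(4)]]] by simp
  next
    assume le: "prodl G xs \<preceq> dp (k - p)"
    \<comment> \<open>Nonnegativity of \<open>k - p\<close> ensures that \<open>nat (k - p)\<close>
      stands for the same exponent below.\<close>
    have "\<one> \<preceq> dp (k - p)" using le_trans[OF _ le] n(5) one_le_iff by blast
    then have "0 \<le> k - p" by (simp add: one_le_iff)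
    then show "int (length xs) \<le> k - p"
      using normal_word_length_le[OF n(4), of "nat (k - p)"] le by simp
  qed
  then show ?thesis using shift n by (auto simp: gsup_def)
qed

section \<open>Cycling and twisted decycling\<close>

text \<open>Equals \<open>iota\<close> when \<open>p\<close> is the infimum of \<open>X\<close>.
  With \<open>p\<close> as a parameter, the same formula applies to every conjugate, whatever its
  infimum.\<close>

definition start :: "int \<Rightarrow> 'a \<Rightarrow> 'a" where
  "start p X = (X \<otimes> dp (- p)) \<curlywedge> D"

text \<open>Equals the complement of \<open>phi\<close> when \<open>q\<close> is the supremum of
  \<open>X\<close>; it is the analogue of \<open>start\<close> for the inverse of
  \<open>X\<close>.\<close>

definition finish :: "int \<Rightarrow> 'a \<Rightarrow> 'a" where
  "finish q X = (inv X \<otimes> dp q) \<curlywedge> D"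

lemma start_closed [simp]: "X \<in> carrier G \<Longrightarrow> start p X \<in> carrier G"
  and finish_closed [simp]: "X \<in> carrier G \<Longrightarrow> finish q X \<in> carrier G"
  by (simp_all add: start_def finish_def)

lemma iota_eq_start:
  assumes Y: "Y \<in> carrier G" shows "iota G P D Y = start (ginf G P D Y) Y"
proof -
  obtain p xs where n: "lnf G P D Y = (p, xs)" "Y = dp p \<otimes> prodl G xs"
    "normal_word xs" "prodl G xs \<in> P" using lnf_cases[OF Y] by metis
  have start: "start p Y = dp p \<otimes> (prodl G xs \<curlywedge> D) \<otimes> dp (- p)"
    using n by (simp add: start_def mult_glb glb_mult_dp m_assoc dp_mult D_dp dp_D_left)
  show ?thesis
  proof (cases xs)
    case Nil
    then show ?thesis using n start glb_absorb1[of \<one> D]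
      by (simp add: iota_def ginf_def one_le_iff dp_mult)
  next
    case (Cons x ys)
    then have "x = prodl G xs \<curlywedge> D" using n normal_word_Cons by simp
    then show ?thesis using n start Cons by (simp add: iota_def ginf_def)
  qed
qed

text \<open>For a power of Delta, the convention that \<open>phi\<close> is \<open>D\<close> gives
  the trivial complement, in agreement with \<open>\<one> \<curlywedge> D\<close>.\<close>

lemma inv_phi_mult_D:
  assumes Y: "Y \<in> carrier G"
  shows "inv (phi G P D Y) \<otimes> D = finish (gsup G P D Y) Y"
proof -
  obtain p xs where n: "lnf G P D Y = (p, xs)" "Y = dp p \<otimes> prodl G xs"
    "normal_word xs" "prodl G xs \<in> P" using lnf_cases[OF Y] by metis
  have "finish (gsup G P D Y) Y = (inv (prodl G xs) \<otimes> dp (int (length xs))) \<curlywedge> D"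
    using n by (simp add: finish_def gsup_def inv_mult_group m_assoc dp_inv dp_mult)
  then show ?thesis
    using inv_last_mult_D[OF n(3)] n(1) glb_absorb1[of \<one> D]
    by (cases "xs = []") (simp_all add: phi_def one_le_iff)
qed

lemma phi_simple: assumes Y: "Y \<in> carrier G" shows "phi G P D Y \<in> S"
proof -
  obtain p xs where "lnf G P D Y = (p, xs)" "normal_word xs" using lnf_cases[OF Y] by metis
  moreover from this have "last xs \<in> S" if "xs \<noteq> []"
    using that normal_word_set last_in_set by blast
  ultimately show ?thesis by (cases "xs = []") (simp_all add: phi_def D_simple)
qed

lemma conjugate_closed [simp]:
  "X \<in> carrier G \<Longrightarrow> a \<in> carrier G \<Longrightarrow> conjugate X a \<in> carrier G"
  by (simp add: conjg_def)

lemma conjugate_mult: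
  "X \<in> carrier G \<Longrightarrow> a \<in> carrier G \<Longrightarrow> b \<in> carrier G \<Longrightarrow>
    conjugate (conjugate X a) b = conjugate X (a \<otimes> b)"
  by (simp add: conjg_def m_assoc inv_mult_group)

lemma conjugate_one [simp]: "X \<in> carrier G \<Longrightarrow> conjugate X \<one> = X"
  by (simp add: conjg_def)

text \<open>Multiplying by \<open>a\<close> removes its inverse from the conjugate. In the result
  \<open>a\<close> occurs only in expressions compatible with meets, which is what
  \<open>transport1_glb\<close> exploits.\<close>

lemma mult_start_conjugate:
  "X \<in> carrier G \<Longrightarrow> a \<in> carrier G \<Longrightarrow>
    a \<otimes> start p (conjugate X a) = (X \<otimes> a \<otimes> dp (- p)) \<curlywedge> (a \<otimes> D)"
  by (simp add: start_def mult_glb conjg_def m_assoc)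

lemma mult_finish_conjugate:
  "X \<in> carrier G \<Longrightarrow> a \<in> carrier G \<Longrightarrow>
    a \<otimes> finish q (conjugate X a) = (inv X \<otimes> a \<otimes> dp q) \<curlywedge> (a \<otimes> D)"
  by (simp add: finish_def mult_glb conjg_def m_assoc inv_mult_group)

text \<open>Both products are the meet of
  \<open>\<Delta>^(q - p)\<close>, \<open>X \<Delta>^(1 - p)\<close>, \<open>X^-1 \<Delta>^(q + 1)\<close> and \<open>\<Delta>^2\<close>.\<close>
lemma start_finish_swap:
  assumes X: "X \<in> carrier G"
  shows "finish q X \<otimes> start p (conjugate X (finish q X))
       = start p X \<otimes> finish q (conjugate X (start p X))"
proof -
  have "X \<otimes> finish q X \<otimes> dp (- p) = dp (q - p) \<curlywedge> (X \<otimes> dp (1 - p))"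
    "finish q X \<otimes> D = (inv X \<otimes> dp (q + 1)) \<curlywedge> dp 2"
    "inv X \<otimes> start p X \<otimes> dp q = dp (q - p) \<curlywedge> (inv X \<otimes> dp (q + 1))"
    "start p X \<otimes> D = (X \<otimes> dp (1 - p)) \<curlywedge> dp 2"
    using X dp_D[of 1]
    by (simp_all add: finish_def start_def mult_glb glb_mult_dp glb_mult_D m_assoc
        dp_mult D_dp dp_D algebra_simps)
  then show ?thesis using X
    by (simp add: mult_start_conjugate mult_finish_conjugate)
      (rule eq_by_lower_bounds, auto simp: le_glb_iff)
qed

definition cyc :: "int \<Rightarrow> 'a \<Rightarrow> 'a" where
  "cyc p X = conjugate X (start p X)"

definition decyc :: "int \<Rightarrow> 'a \<Rightarrow> 'a" where
  "decyc q X = conjugate X (finish q X)"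

lemma cyc_closed [simp]: "X \<in> carrier G \<Longrightarrow> cyc p X \<in> carrier G"
  and decyc_closed [simp]: "X \<in> carrier G \<Longrightarrow> decyc q X \<in> carrier G"
  by (simp_all add: cyc_def decyc_def)

lemma cyc_decyc_commute: "X \<in> carrier G \<Longrightarrow> cyc p (decyc q X) = decyc q (cyc p X)"
  by (simp add: cyc_def decyc_def conjugate_mult start_finish_swap)

lemma cyc_funpow_closed [simp]: "X \<in> carrier G \<Longrightarrow> (cyc p ^^ n) X \<in> carrier G"
  by (induction n) auto

text \<open>Consequently \<open>decyc q\<close> sends elements periodic under \<open>cyc p\<close>
  to periodic ones.\<close>

lemma cyc_funpow_decyc:
  "X \<in> carrier G \<Longrightarrow> (cyc p ^^ n) (decyc q X) = decyc q ((cyc p ^^ n) X)"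
  by (induction n) (auto simp: cyc_decyc_commute)

section \<open>Bounds on infimum and supremum under conjugation\<close>

lemma dp_le_conjugate_iff:
  "X \<in> carrier G \<Longrightarrow> a \<in> carrier G \<Longrightarrow> dp p \<preceq> conjugate X a \<longleftrightarrow> a \<otimes> dp p \<preceq> X \<otimes> a"
  using mult_left_le_iff[of a "dp p" "conjugate X a"] by (simp add: conjg_def m_assoc)

lemma conjugate_le_dp_iff:
  "X \<in> carrier G \<Longrightarrow> a \<in> carrier G \<Longrightarrow> conjugate X a \<preceq> dp q \<longleftrightarrow> X \<otimes> a \<preceq> a \<otimes> dp q"
  using mult_left_le_iff[of a "conjugate X a" "dp q"] by (simp add: conjg_def m_assoc)

text \<open>Infimum at least \<open>p\<close> and supremum at most \<open>q\<close>; for the optimal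
  values in a conjugacy class, this cuts out the super summit set.\<close>

definition band :: "int \<Rightarrow> int \<Rightarrow> 'a set" where
  "band p q = {X. dp p \<preceq> X \<and> X \<preceq> dp q}"

lemma band_closed: "X \<in> band p q \<Longrightarrow> X \<in> carrier G"
  using le_carrier by (auto simp: band_def)

text \<open>Written as \<open>a \<otimes> dp p \<preceq> X \<otimes> a\<close> and
  \<open>X \<otimes> a \<preceq> a \<otimes> dp q\<close>, the bounds have sides compatible with
  meets in \<open>a\<close>.\<close>

lemma glb_conjugate_band:
  assumes X: "X \<in> carrier G" and ab: "a \<in> carrier G" "b \<in> carrier G"
    and "conjugate X a \<in> band p q" "conjugate X b \<in> band p q"
  shows "conjugate X (a \<curlywedge> b) \<in> band p q"
proof -
  have *: "a \<otimes> dp p \<preceq> X \<otimes> a" "b \<otimes> dp p \<preceq> X \<otimes> b" "X \<otimes> a \<preceq> a \<otimes> dp q" "X \<otimes> b \<preceq> b \<otimes> dp q"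
    using assms by (simp_all add: band_def dp_le_conjugate_iff conjugate_le_dp_iff)
  have mono: "a1 \<curlywedge> b1 \<preceq> a2 \<curlywedge> b2" if "a1 \<preceq> a2" "b1 \<preceq> b2" for a1 b1 a2 b2
    using that le_carrier[OF that(1)] le_carrier[OF that(2)] le_trans
    by (meson glb_le1 glb_le2 le_glb_iff)
  show ?thesis using X ab mono[OF *(1,2)] mono[OF *(3,4)]
    by (simp add: band_def dp_le_conjugate_iff conjugate_le_dp_iff glb_mult_dp mult_glb)
qed

lemma start_pos: assumes "X \<in> band p q" shows "start p X \<in> P"
proof -
  have X: "X \<in> carrier G" using assms band_closed by blast
  have "\<one> \<preceq> X \<otimes> dp (- p)" using assms X by (simp add: band_def le_mult_dp_move)
  then show ?thesis by (simp add: start_def glb_P one_le_iff)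
qed

lemma finish_pos: assumes "X \<in> band p q" shows "finish q X \<in> P"
proof -
  have X: "X \<in> carrier G" using assms band_closed by blast
  have "\<one> \<preceq> inv X \<otimes> dp q" using assms X by (simp add: band_def prefix_def)
  then show ?thesis by (simp add: finish_def glb_P one_le_iff)
qed

lemma finish_simple: assumes "X \<in> band p q" shows "finish q X \<in> S"
  using finish_pos[OF assms] glb_le2[of "inv X \<otimes> dp q" D] band_closed[OF assms]
  by (simp add: simples_iff finish_def)

lemma cyc_band: assumes "X \<in> band p q" shows "cyc p X \<in> band p q"
proof -
  have X: "X \<in> carrier G" using assms band_closed by blast
  have pq: "dp p \<preceq> X" "X \<preceq> dp q" using assms by (auto simp: band_def)
  let ?A = "start p X"
  have A: "?A \<preceq> X \<otimes> dp (- p)" "?A \<preceq> D" "?A \<in> P"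
    using X glb_le1 glb_le2 start_pos[OF assms] by (auto simp: start_def)
  have "X \<otimes> dp (- p) \<preceq> X \<otimes> ?A \<otimes> dp (- p)" using X A by (simp add: le_mult_pos)
  with A(1) have "?A \<preceq> X \<otimes> ?A \<otimes> dp (- p)" by (rule le_trans)
  then have "?A \<otimes> dp p \<preceq> X \<otimes> ?A" using X by (simp add: le_mult_dp_move)
  \<comment> \<open>The target \<open>?A \<otimes> dp q\<close> is the meet of
    \<open>X \<otimes> dp (q - p)\<close> and \<open>dp (q + 1)\<close>, so the upper bound splits
    into this inequality and the next.\<close>
  moreover have "X \<otimes> ?A \<preceq> X \<otimes> dp (q - p)"
  proof -
    have "X \<otimes> dp (- p) \<preceq> dp q \<otimes> dp (- p)" using X pq by simp
    then have "?A \<preceq> dp (q - p)" using le_trans[OF A(1)] by (simp add: dp_mult)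
    then show ?thesis using X by simp
  qed
  moreover have "X \<otimes> ?A \<preceq> dp (q + 1)"
  proof -
    have "X \<otimes> ?A \<preceq> X \<otimes> D" using X A by simp
    moreover have "X \<otimes> D \<preceq> dp q \<otimes> D" using X pq by simp
    ultimately show ?thesis unfolding dp_D by (rule le_trans)
  qed
  moreover have "?A \<otimes> dp q = (X \<otimes> dp (q - p)) \<curlywedge> dp (q + 1)"
    using X by (simp add: start_def glb_mult_dp m_assoc dp_mult D_dp add.commute)
  ultimately show ?thesis
    using X by (simp add: band_def cyc_def dp_le_conjugate_iff conjugate_le_dp_iff le_glb_iff)
qed

lemma decyc_band: assumes "X \<in> band p q" shows "decyc q X \<in> band p q"
proof -
  have X: "X \<in> carrier G" using assms band_closed by blast
  have pq: "dp p \<preceq> X" "X \<preceq> dp q" using assms by (auto simp: band_def)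
  let ?B = "finish q X"
  have B: "?B \<preceq> inv X \<otimes> dp q" "?B \<preceq> D" "?B \<in> P"
    using X glb_le1 glb_le2 finish_pos[OF assms] by (auto simp: finish_def)
  \<comment> \<open>This meet splits the lower bound
    \<open>?B \<otimes> dp p \<preceq> X \<otimes> ?B\<close> into two inequalities, proved in
    turn.\<close>
  have XB: "X \<otimes> ?B = dp q \<curlywedge> (X \<otimes> D)"
    using X by (simp add: finish_def mult_glb)
  have "?B \<otimes> dp p \<preceq> inv X \<otimes> dp q \<otimes> dp p" using B X by simp
  moreover have "inv X \<otimes> dp q \<otimes> dp p \<preceq> dp q"
  proof -
    have "inv X \<preceq> dp (- p)" using X pq by (simp add: inv_le_dp)
    then have "inv X \<otimes> dp (q + p) \<preceq> dp (- p) \<otimes> dp (q + p)" using X by simp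
    then show ?thesis using X by (simp add: m_assoc dp_mult)
  qed
  ultimately have "?B \<otimes> dp p \<preceq> dp q" by (rule le_trans)
  moreover have "?B \<otimes> dp p \<preceq> X \<otimes> D"
  proof -
    have "?B \<otimes> dp p \<preceq> D \<otimes> dp p" using B X by simp
    also have "D \<otimes> dp p = dp p \<otimes> D" by (simp add: dp_D D_dp add.commute)
    also have "dp p \<otimes> D \<preceq> X \<otimes> D" using X pq by simp
    finally (le_trans) show ?thesis .
  qed
  ultimately have "?B \<otimes> dp p \<preceq> X \<otimes> ?B" using X by (simp add: XB le_glb_iff)
  moreover have "X \<otimes> ?B \<preceq> ?B \<otimes> dp q"
  proof -
    have "X \<otimes> ?B \<preceq> dp q" using X glb_le1[of "dp q" "X \<otimes> D"] by (simp add: XB)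
    moreover have "\<one> \<otimes> dp q \<preceq> ?B \<otimes> dp q"
      using X B by (subst le_mult_dp_iff) (auto simp: one_le_iff)
    ultimately show ?thesis using le_trans[of _ "dp q"] by simp
  qed
  ultimately show ?thesis
    using X by (simp add: band_def decyc_def dp_le_conjugate_iff conjugate_le_dp_iff)
qed

section \<open>Transport along cycling\<close>

text \<open>Viewing \<open>a\<close> as an arrow from \<open>X\<close> to its conjugate, this is the
  arrow between the cycled elements that closes the square; see
  \<open>conjugate_transport1\<close>.\<close>

definition transport1 :: "int \<Rightarrow> 'a \<Rightarrow> 'a \<Rightarrow> 'a" where
  "transport1 p X a = inv (start p X) \<otimes> (a \<otimes> start p (conjugate X a))"

primrec transport :: "int \<Rightarrow> nat \<Rightarrow> 'a \<Rightarrow> 'a \<Rightarrow> 'a" where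
  "transport p 0 X a = a"
| "transport p (Suc n) X a = transport p n (cyc p X) (transport1 p X a)"

lemma transport1_closed [simp]:
  "X \<in> carrier G \<Longrightarrow> a \<in> carrier G \<Longrightarrow> transport1 p X a \<in> carrier G"
  by (simp add: transport1_def)

lemma transport_closed [simp]:
  "X \<in> carrier G \<Longrightarrow> a \<in> carrier G \<Longrightarrow> transport p n X a \<in> carrier G"
  by (induction n arbitrary: X a) auto

lemma conjugate_transport1:
  "X \<in> carrier G \<Longrightarrow> a \<in> carrier G \<Longrightarrow>
    conjugate (cyc p X) (transport1 p X a) = cyc p (conjugate X a)"
  by (simp add: cyc_def transport1_def conjugate_mult)

lemma conjugate_transport:
  "X \<in> carrier G \<Longrightarrow> a \<in> carrier G \<Longrightarrow>
    conjugate ((cyc p ^^ n) X) (transport p n X a) = (cyc p ^^ n) (conjugate X a)"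
  by (induction n arbitrary: X a) (auto simp: conjugate_transport1 funpow_swap1)

lemma transport1_glb:
  assumes "X \<in> carrier G" "a \<in> carrier G" "b \<in> carrier G"
  shows "transport1 p X (a \<curlywedge> b) = transport1 p X a \<curlywedge> transport1 p X b"
proof -
  have "(a \<curlywedge> b) \<otimes> start p (conjugate X (a \<curlywedge> b))
    = (a \<otimes> start p (conjugate X a)) \<curlywedge> (b \<otimes> start p (conjugate X b))"
    using assms
    by (simp add: mult_start_conjugate mult_glb glb_mult_dp glb_mult_D)
      (rule eq_by_lower_bounds, auto simp: le_glb_iff)
  then show ?thesis using assms by (simp add: transport1_def mult_glb)
qed

lemma transport_glb:
  "X \<in> carrier G \<Longrightarrow> a \<in> carrier G \<Longrightarrow> b \<in> carrier G \<Longrightarrow>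
    transport p n X (a \<curlywedge> b) = transport p n X a \<curlywedge> transport p n X b"
  by (induction n arbitrary: X a b) (auto simp: transport1_glb)

lemma transport_one: "X \<in> carrier G \<Longrightarrow> transport p n X \<one> = \<one>"
  by (induction n arbitrary: X) (auto simp: transport1_def)

lemma transport1_D: assumes "X \<in> carrier G" shows "transport1 p X D = D"
proof -
  have "D \<otimes> start p (conjugate X D) = start p X \<otimes> D"
    using assms
    by (subst mult_start_conjugate)
      (simp_all add: start_def glb_mult_D m_assoc dp_D D_dp)
  then show ?thesis using assms by (simp add: transport1_def)
qed

lemma transport_D: "X \<in> carrier G \<Longrightarrow> transport p n X D = D"
  by (induction n arbitrary: X) (auto simp: transport1_D)

lemma le_iff_glb: "a \<in> carrier G \<Longrightarrow> b \<in> carrier G \<Longrightarrow> a \<preceq> b \<longleftrightarrow> a \<curlywedge> b = a"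
  using glb_absorb1 glb_le2 by metis

lemma transport_mono:
  assumes "X \<in> carrier G" "a \<preceq> b" shows "transport p n X a \<preceq> transport p n X b"
  using assms le_carrier[OF assms(2)] transport_glb[of X a b p n]
  by (simp add: le_iff_glb)

text \<open>Transport is monotone and fixes both \<open>\<one>\<close> and \<open>D\<close>, so it
  preserves the interval between them.\<close>

lemma transport_simple: "X \<in> carrier G \<Longrightarrow> a \<in> S \<Longrightarrow> transport p n X a \<in> S"
  using transport_mono[of X \<one> a p n] transport_mono[of X a D p n]
  by (simp add: simples_iff transport_one transport_D one_le_iff)

text \<open>When both conjugates coincide, the two transports differ only in the middle factor, and
  the common outer factors cancel.\<close>

lemma transport_inj:
  assumes "X \<in> carrier G" "a \<in> carrier G" "b \<in> carrier G" "conjugate X a = conjugate X b"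
    "transport p n X a = transport p n X b"
  shows "a = b"
  using assms
proof (induction n arbitrary: X a b)
  case (Suc n)
  have conj_eq: "conjugate (cyc p X) (transport1 p X a) = conjugate (cyc p X) (transport1 p X b)"
    using Suc.prems by (simp add: conjugate_transport1)
  have "transport p n (cyc p X) (transport1 p X a) = transport p n (cyc p X) (transport1 p X b)"
    using Suc.prems(5) by simp
  with conj_eq have "transport1 p X a = transport1 p X b"
    by (rule Suc.IH[of "cyc p X", rotated 3]) (use Suc.prems(1-3) in simp_all)
  then show ?case using Suc.prems by (simp add: transport1_def)
qed simp

lemma transport_add:
  "X \<in> carrier G \<Longrightarrow> a \<in> carrier G \<Longrightarrow>
    transport p (m + n) X a = transport p n ((cyc p ^^ m) X) (transport p m X a)"
  by (induction m arbitrary: X a) (auto simp: funpow_swap1)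

lemma funpow_mult_fixed: "(f ^^ n) x = x \<Longrightarrow> (f ^^ (k * n)) x = x"
  by (induction k) (auto simp: funpow_add)

lemma transport_mult:
  assumes "X \<in> carrier G" "a \<in> carrier G" "(cyc p ^^ n) X = X"
  shows "transport p (k * n) X a = ((transport p n X) ^^ k) a"
  using assms
  by (induction k) (auto simp: transport_add funpow_mult_fixed add.commute[of n])

text \<open>Transport around a common cycling period permutes the finite set of simple elements
  conjugating \<open>X\<close> to a given element, so a power of it is the identity.\<close>
lemma transport_recurrent:
  assumes X: "X \<in> carrier G" and a: "a \<in> S"
    and n: "n > 0" "(cyc p ^^ n) X = X" and m: "m > 0" "(cyc p ^^ m) (conjugate X a) = conjugate X a"
  shows "\<exists>k>0. (cyc p ^^ k) X = X \<and> transport p k X a = a"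
proof -
  define N where "N = m * n"
  have N: "N > 0" "(cyc p ^^ N) X = X" "(cyc p ^^ N) (conjugate X a) = conjugate X a"
    unfolding N_def
    using n(1) m(1) funpow_mult_fixed[OF n(2), of m] funpow_mult_fixed[OF m(2), of n]
    by (simp_all add: mult.commute[of n])
  define T where "T = {b \<in> S. conjugate X b = conjugate X a}"
  define f where "f = transport p N X"
  \<comment> \<open>Extending \<open>f\<close> by the identity outside \<open>T\<close> gives a
    function injective on the whole type, as \<open>funpow_inj_finite\<close> demands.\<close>
  define g where "g b = (if b \<in> T then f b else b)" for b
  have fT: "f b \<in> T" if "b \<in> T" for b
    using that X N conjugate_transport[of X b N p] transport_simple[of X b p N]
    by (simp add: T_def f_def)
  have f_inj: "b = c" if "b \<in> T" "c \<in> T" "f b = f c" for b c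
    using that X by (intro transport_inj[of X b c p N]) (auto simp: T_def f_def)
  have inj: "inj g" using fT f_inj unfolding inj_def g_def by metis
  have g_iter: "(g ^^ k) a \<in> T \<and> (g ^^ k) a = (f ^^ k) a" for k
  proof (induction k)
    case 0
    show ?case using a by (simp add: T_def)
  next
    case (Suc k)
    then have b: "(g ^^ k) a \<in> T" by blast
    then have "g ((g ^^ k) a) = f ((g ^^ k) a)" unfolding g_def[of "(g ^^ k) a"] by (rule if_P)
    then show ?case using fT[OF b] Suc by simp
  qed
  have "finite T" using finite_simples by (simp add: T_def)
  then have "finite {y. \<exists>k. y = (g ^^ k) a}"
    by (rule rev_finite_subset) (use g_iter in blast)
  then obtain k where k: "k > 0" "(g ^^ k) a = a" by (rule funpow_inj_finite[OF inj])
  then have "(f ^^ k) a = a" using g_iter[of k] by (metis (no_types))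
  moreover have "transport p (k * N) X a = (f ^^ k) a"
    unfolding f_def using X simples_closed[OF a] N(2) by (rule transport_mult)
  ultimately have "transport p (k * N) X a = a" by (rule trans[rotated])
  moreover have "k * N > 0" using k(1) N(1) by simp
  ultimately show ?thesis using funpow_mult_fixed[OF N(2)] by blast
qed

text \<open>A common multiple of the recurrence times of \<open>a\<close> and \<open>b\<close>
  yields a transport fixing both, hence also their meet; \<open>conjugate_transport\<close> turns
  this into periodicity of the conjugate.\<close>

lemma cyc_periodic_glb:
  assumes X: "X \<in> carrier G" and ab: "a \<in> S" "b \<in> S"
    and "\<exists>n>0. (cyc p ^^ n) X = X"
    and "\<exists>n>0. (cyc p ^^ n) (conjugate X a) = conjugate X a"
    and "\<exists>n>0. (cyc p ^^ n) (conjugate X b) = conjugate X b"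
  shows "\<exists>n>0. (cyc p ^^ n) (conjugate X (a \<curlywedge> b)) = conjugate X (a \<curlywedge> b)"
proof -
  obtain j k where j: "j > 0" "(cyc p ^^ j) X = X" "transport p j X a = a"
    and k: "k > 0" "(cyc p ^^ k) X = X" "transport p k X b = b"
    using assms transport_recurrent by metis
  have "((transport p j X) ^^ k) a = a" "((transport p k X) ^^ j) b = b"
    using funpow_mult_fixed[of 1 "transport p j X" a k] funpow_mult_fixed[of 1 "transport p k X" b j] j k
    by simp_all
  then have "transport p (k * j) X a = a" "transport p (j * k) X b = b"
    using transport_mult[of X a j p k] transport_mult[of X b k p j] j k X ab by simp_all
  then have "transport p (j * k) X (a \<curlywedge> b) = a \<curlywedge> b"
    using X ab by (simp add: transport_glb mult.commute)
  moreover have "(cyc p ^^ (j * k)) X = X" using k by (rule_tac funpow_mult_fixed)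
  ultimately have "(cyc p ^^ (j * k)) (conjugate X (a \<curlywedge> b)) = conjugate X (a \<curlywedge> b)"
    using conjugate_transport[of X "a \<curlywedge> b" "j * k" p] X ab by simp
  then show ?thesis using j k by (intro exI[of _ "j * k"]) simp
qed

section \<open>Ultra summit sets\<close>

lemma conj_class_closed: "X \<in> carrier G \<Longrightarrow> Y \<in> conj_class G X \<Longrightarrow> Y \<in> carrier G"
  by (auto simp: conj_class_def)

lemma conjugate_conj_class:
  "X \<in> carrier G \<Longrightarrow> Y \<in> conj_class G X \<Longrightarrow> a \<in> carrier G \<Longrightarrow> conjugate Y a \<in> conj_class G X"
  by (auto simp: conj_class_def conjugate_mult)

context
  fixes X p q
  assumes X: "X \<in> carrier G" "X \<in> SSS G P D X"
    and p: "p = ginf G P D X" and q: "q = gsup G P D X"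
begin

text \<open>As \<open>X\<close> is in its own super summit set, \<open>p\<close> and
  \<open>q\<close> are the optimal values in the class.\<close>

lemma SSS_iff_band: "Y \<in> SSS G P D X \<longleftrightarrow> Y \<in> conj_class G X \<and> Y \<in> band p q"
proof -
  have "Y \<in> band p q \<longleftrightarrow> p \<le> ginf G P D Y \<and> gsup G P D Y \<le> q" if "Y \<in> conj_class G X"
    using conj_class_closed[OF X(1) that] by (simp add: band_def le_ginf_iff gsup_le_iff)
  then show ?thesis using X(2) unfolding SSS_def p q by fastforce
qed

lemma cyc_SSS: "Y \<in> SSS G P D X \<Longrightarrow> cyc p Y \<in> SSS G P D X"
  using SSS_iff_band cyc_band conjugate_conj_class X(1) conj_class_closed
  by (simp add: cyc_def)

text \<open>All super summit elements share the infimum \<open>p\<close>, so a fixed exponent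
  describes cycling along the whole orbit.\<close>

lemma cycling_eq_cyc: assumes "Y \<in> SSS G P D X" shows "cycling G P D Y = cyc p Y"
proof -
  have "ginf G P D Y = p" using assms X(2) unfolding SSS_def p by (auto intro: order_antisym)
  moreover have "Y \<in> carrier G" using assms X(1) conj_class_closed by (auto simp: SSS_def)
  ultimately show ?thesis by (simp add: cycling_def cyc_def iota_eq_start)
qed

lemma cycling_funpow_eq_cyc:
  assumes "Y \<in> SSS G P D X" shows "(cycling G P D ^^ n) Y = (cyc p ^^ n) Y"
proof -
  have "(cycling G P D ^^ n) Y = (cyc p ^^ n) Y \<and> (cyc p ^^ n) Y \<in> SSS G P D X"
    by (induction n) (use assms cycling_eq_cyc cyc_SSS in auto)
  then show ?thesis by blast
qed

lemma USS_iff: "Y \<in> USS G P D X \<longleftrightarrow>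
    Y \<in> conj_class G X \<and> Y \<in> band p q \<and> (\<exists>n>0. (cyc p ^^ n) Y = Y)"
  using SSS_iff_band cycling_funpow_eq_cyc by (auto simp: USS_def)

text \<open>Conjugation by \<open>finish q X\<close> stays in the band and commutes with cycling,
  hence lands in the ultra summit set; closure under meets does the rest.\<close>

lemma USS_glb_finish:
  assumes XU: "X \<in> USS G P D X" and s: "s \<in> S" "conjugate X s \<in> USS G P D X"
  shows "conjugate X (finish q X \<curlywedge> s) \<in> USS G P D X"
proof -
  have XB: "X \<in> band p q" "\<exists>n>0. (cyc p ^^ n) X = X" using XU USS_iff by blast+
  have "\<exists>n>0. (cyc p ^^ n) (decyc q X) = decyc q X"
    using XB(2) X(1) cyc_funpow_decyc by metis
  then have per: "\<exists>n>0. (cyc p ^^ n) (conjugate X (finish q X \<curlywedge> s)) = conjugate X (finish q X \<curlywedge> s)"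
    using cyc_periodic_glb[OF X(1) finish_simple[OF XB(1)] s(1) XB(2)] s(2) USS_iff
    by (simp add: decyc_def)
  have "conjugate X (finish q X \<curlywedge> s) \<in> band p q"
    using glb_conjugate_band[OF X(1), of "finish q X" s] decyc_band[OF XB(1)] s X(1) USS_iff
    by (simp add: decyc_def)
  moreover have "conjugate X (finish q X \<curlywedge> s) \<in> conj_class G X"
    using X(1) s by (auto simp: conj_class_def)
  ultimately show ?thesis using per USS_iff by blast
qed

end

section \<open>The dichotomy for minimal simple elements\<close>

lemma mult_simple_iff:
  assumes "a \<in> S" "s \<in> S" shows "a \<otimes> s \<in> S \<longleftrightarrow> s \<preceq> inv a \<otimes> D"
  using assms mult_left_le_iff[of a s "inv a \<otimes> D"] by (simp add: simples_iff)

text \<open>Inequality of the two truth values expresses that exactly one alternative holds.\<close>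

lemma phi_minimal_simple:
  assumes X: "X \<in> carrier G" "X \<in> USS G P D X" and s: "minimal_simple G P D X X s"
  shows "(phi G P D X \<otimes> s \<in> S) \<noteq> left_weighted G P D (phi G P D X) s"
proof -
  define q where "q = gsup G P D X"
  define t where "t = finish q X \<curlywedge> s"
  have XS: "X \<in> SSS G P D X" using X by (simp add: USS_def)
  have sS: "s \<in> S" "s \<noteq> \<one>" "conjugate X s \<in> USS G P D X"
    and smin: "\<And>t. t \<in> S \<Longrightarrow> t \<preceq> s \<Longrightarrow> t \<noteq> \<one> \<Longrightarrow> t \<noteq> s \<Longrightarrow> conjugate X t \<notin> USS G P D X"
    using s unfolding minimal_simple_def by auto
  have "X \<in> band (ginf G P D X) q"
    using USS_iff[OF X(1) XS refl refl] X(2) unfolding q_def by blast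
  then have F: "finish q X \<in> P" by (rule finish_pos)
  have "t \<in> S" "t \<preceq> s" using F sS by (simp_all add: t_def glb_simple glb_le2)
  moreover have "conjugate X t \<in> USS G P D X"
    unfolding t_def q_def using USS_glb_finish[OF X(1) XS refl refl X(2) sS(1,3)] .
  ultimately have t: "t = \<one> \<or> t = s" using smin by blast
  have dual: "inv (phi G P D X) \<otimes> D = finish q X" using X by (simp add: inv_phi_mult_D q_def)
  \<comment> \<open>The alternatives amount to \<open>t = s\<close> and \<open>t = \<one>\<close>;
    they exclude each other because \<open>s\<close> is nontrivial.\<close>
  have "phi G P D X \<otimes> s \<in> S \<longleftrightarrow> t = s"
    using phi_simple[OF X(1)] sS F
    by (simp add: mult_simple_iff dual le_iff_glb t_def glb_commute[of s])
  moreover have "left_weighted G P D (phi G P D X) s \<longleftrightarrow> t = \<one>"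
    using phi_simple[OF X(1)] sS by (simp add: left_weighted_def dual t_def)
  ultimately show ?thesis using t sS(2) by blast
qed

end

theorem theorem2:
  fixes G :: "'a monoid" and P :: "'a set" and D :: 'a and X s :: 'a
  assumes "garside_group G P D"
    and "X \<in> carrier G"
    and "X \<in> USS G P D X"
    and "minimal_simple G P D X X s"
  shows "(phi G P D X \<otimes>\<^bsub>G\<^esub> s \<in> simples G P D) \<noteq> left_weighted G P D (phi G P D X) s"
proof -
  interpret group G using assms(1) by (simp add: garside_group_def)
  \<comment> \<open>If \<open>D\<close> were trivial, \<open>s\<close> and its inverse would both be
    positive, so \<open>s\<close> would be trivial, against its minimality.\<close>
  have "D \<noteq> \<one>\<^bsub>G\<^esub>"
  proof
    assume "D = \<one>\<^bsub>G\<^esub>"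
    then have "s \<in> carrier G" "s \<in> P" "inv\<^bsub>G\<^esub> s \<in> P" "s \<noteq> \<one>\<^bsub>G\<^esub>"
      using assms(4) by (auto simp: minimal_simple_def simples_def prefix_def)
    then show False using assms(1) by (auto simp: garside_group_def)
  qed
  then interpret garside_structure G P D
    using assms(1) by unfold_locales
  show ?thesis using assms(2-4) by (rule phi_minimal_simple)
qed

end
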